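(* Fix a level $c$ of $C$. Assume that for all $a,a^*\in\{0,1\}$ and all $m$, $$Y_{am}\perp A\mid (C,U),\quad Y_{am}\perp M\mid (A,C,U),\quad M_a\perp A\mid (C,U),\quad Y_{am}\perp M_{a^*}\mid (C,U),$$ and that $A\perp U\mid C$. Then the true conditional natural indirect effect on the risk difference scale satisfies $$\mathrm{NIE}^{\mathrm{true}}_{\mathrm{RD}|c}\;\le\;P(Y=1\mid A=1,c)\;-\;\sum_m P(Y=1\mid A=1,m,c)\,P(m\mid A=0,c)\big/\mathrm{BF}_{U|(M,c)},$$ and this bound is sharp, i.e. attainable: for all finite $\gamma,\delta\ge 1$ there is a joint distribution satisfying all the assumptions, with $\mathrm{RR}_{AU|(M,c)}=\gamma$ and $\mathrm{RR}_{UY|(A=1,M,c)}=\delta$, for which equality holds.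
   Context: Setting. $A\in\{0,1\}$ is a binary exposure, $Y\in\{0,1\}$ a binary outcome, $M$ a categorical mediator, $C$ categorical observed baseline covariates and $U$ categorical unmeasured baseline covariates ($M$, $C$, $U$ take finitely many values; they may be vectors). $Y_a$ and $M_a$ are the potential outcome and potential mediator under exposure $a$; $Y_{am}$ is the potential outcome under exposure $a$ and mediator value $m$; $Y_{aM_{a^*}}$ is the potential outcome under exposure $a$ with the mediator set to $M_{a^*}$. Consistency: $Y_a=Y$ and $M_a=M$ if $A=a$; $Y_{am}=Y$ if $A=a$ and $M=m$. Composition: $Y_{aM_a}=Y_a$ for $a=0,1$. The symbol $\perp$ denotes (conditional) independence; lower-case $m,c,u$ in conditional probabilities stand for the events $M=m$, $C=c$, $U=u$. Effect. $\mathrm{NIE}^{\mathrm{true}}_{\mathrm{RD}|c}=P(Y_{1M_1}=1\mid c)-P(Y_{1M_0}=1\mid c)$. Sensitivity parameters. $$\mathrm{RR}_{UY|(A=1,M,c)}=\max_m\frac{\max_u P(Y=1\mid A=1,m,c,u)}{\min_u P(Y=1\mid A=1,m,c,u)},\qquad \mathrm{RR}_{AU|(M,c)}=\max_m\max_u\frac{P(u\mid A=1,m,c)}{P(u\mid A=0,m,c)}.$$ Bounding factor: $$\mathrm{BF}_{U|(M,c)}=\frac{\mathrm{RR}_{AU|(M,c)}\times \mathrm{RR}_{UY|(A=1,M,c)}}{\mathrm{RR}_{AU|(M,c)}+\mathrm{RR}_{UY|(A=1,M,c)}-1}.$$ Conventions. $P(C=c)>0$, $P(A=a\mid c)>0$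 for $a=0,1$, and $P(m\mid A=1,c)>0$ whenever $P(m\mid A=0,c)>0$. Maxima over $m$ are over $m$ with $P(m\mid A=0,c)>0$, and the sum over $m$ is over the same values; $u$ ranges over values with $P(u\mid c)>0$. $P(Y=1\mid A=a,m,c,u)$ is understood as $P(Y_{am}=1\mid c,u)$ (with which it coincides under the independence assumptions) when its conditioning event has probability zero. A positive number over $0$ is $+\infty$; ratios $0/0$ are omitted from the maximum defining $\mathrm{RR}_{AU|(M,c)}$ and are read as $1$ in $\mathrm{RR}_{UY|(A=1,M,c)}$. If exactly one sensitivity parameter is infinite, $\mathrm{BF}_{U|(M,c)}$ equals the other; if both are, $\mathrm{BF}_{U|(M,c)}=\infty$ and $x/\infty=0$. *)

theory Defs
  imports "HOL-Probability.Probability"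
begin

text \<open>
  Binary exposures and outcomes have type \<open>bool\<close>, with \<open>True\<close> for 1 and \<open>False\<close> for 0.
  Mediator and covariates are categorical: their value types are of class \<open>finite\<close>
  wherever maxima or sums over levels are taken.
\<close>

record ('w, 'm, 'c, 'u) mediation =
  law :: "'w measure"
  expo :: "'w \<Rightarrow> bool"
  outc :: "'w \<Rightarrow> bool"
  medi :: "'w \<Rightarrow> 'm"
  cova :: "'w \<Rightarrow> 'c"
  unme :: "'w \<Rightarrow> 'u"
  Y_pot :: "bool \<Rightarrow> 'w \<Rightarrow> bool"
  M_pot :: "bool \<Rightarrow> 'w \<Rightarrow> 'm"
  Y_joint :: "bool \<Rightarrow> 'm \<Rightarrow> 'w \<Rightarrow> bool"

text \<open>\<open>Y_nested G a a'\<close> is the outcome under exposure \<open>a\<close> with the mediator set to \<open>M\<^sub>a\<^sub>'\<close>.\<close>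

definition Y_nested ::
    "('w, 'm, 'c, 'u) mediation \<Rightarrow> bool \<Rightarrow> bool \<Rightarrow> 'w \<Rightarrow> bool" where
  "Y_nested G a a' \<omega> = Y_joint G a (M_pot G a' \<omega>) \<omega>"

definition random_variables :: "('w, 'm, 'c, 'u) mediation \<Rightarrow> bool" where
  "random_variables G \<longleftrightarrow>
     expo G \<in> measurable (law G) (count_space UNIV) \<and>
     outc G \<in> measurable (law G) (count_space UNIV) \<and>
     medi G \<in> measurable (law G) (count_space UNIV) \<and>
     cova G \<in> measurable (law G) (count_space UNIV) \<and>
     unme G \<in> measurable (law G) (count_space UNIV) \<and>
     (\<forall>a. Y_pot G a \<in> measurable (law G) (count_space UNIV)) \<and>
     (\<forall>a. M_pot G a \<in> measurable (law G) (count_space UNIV)) \<and>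
     (\<forall>a m. Y_joint G a m \<in> measurable (law G) (count_space UNIV))"

definition consistency :: "('w, 'm, 'c, 'u) mediation \<Rightarrow> bool" where
  "consistency G \<longleftrightarrow> (\<forall>\<omega>\<in>space (law G). \<forall>a. expo G \<omega> = a \<longrightarrow>
     Y_pot G a \<omega> = outc G \<omega> \<and> M_pot G a \<omega> = medi G \<omega> \<and>
     (\<forall>m. medi G \<omega> = m \<longrightarrow> Y_joint G a m \<omega> = outc G \<omega>))"

definition composition :: "('w, 'm, 'c, 'u) mediation \<Rightarrow> bool" where
  "composition G \<longleftrightarrow> (\<forall>\<omega>\<in>space (law G). \<forall>a. Y_nested G a a \<omega> = Y_pot G a \<omega>)"

text \<open>Conditional independence of discrete random variables.\<close>

definition cond_indep ::
    "'w measure \<Rightarrow> ('w \<Rightarrow> 'x) \<Rightarrow> ('w \<Rightarrow> 'y) \<Rightarrow> ('w \<Rightarrow> 'z) \<Rightarrow> bool" where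
  "cond_indep P X Y Z \<longleftrightarrow> (\<forall>x y z. \<P>(\<omega> in P. Z \<omega> = z) > 0 \<longrightarrow>
     \<P>(\<omega> in P. X \<omega> = x \<and> Y \<omega> = y \<bar> Z \<omega> = z) =
     \<P>(\<omega> in P. X \<omega> = x \<bar> Z \<omega> = z) * \<P>(\<omega> in P. Y \<omega> = y \<bar> Z \<omega> = z))"

definition no_confounding :: "('w, 'm, 'c, 'u) mediation \<Rightarrow> bool" where
  "no_confounding G \<longleftrightarrow> (\<forall>a a' m.
     cond_indep (law G) (Y_joint G a m) (expo G) (\<lambda>\<omega>. (cova G \<omega>, unme G \<omega>)) \<and>
     cond_indep (law G) (Y_joint G a m) (medi G) (\<lambda>\<omega>. (expo G \<omega>, cova G \<omega>, unme G \<omega>)) \<and>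
     cond_indep (law G) (M_pot G a) (expo G) (\<lambda>\<omega>. (cova G \<omega>, unme G \<omega>)) \<and>
     cond_indep (law G) (Y_joint G a m) (M_pot G a') (\<lambda>\<omega>. (cova G \<omega>, unme G \<omega>)))"

definition p_med :: "('w, 'm, 'c, 'u) mediation \<Rightarrow> bool \<Rightarrow> 'c \<Rightarrow> 'm \<Rightarrow> real" where
  "p_med G a c m = \<P>(\<omega> in law G. medi G \<omega> = m \<bar> expo G \<omega> = a \<and> cova G \<omega> = c)"

definition positivity :: "('w, 'm, 'c, 'u) mediation \<Rightarrow> 'c \<Rightarrow> bool" where
  "positivity G c \<longleftrightarrow>
     \<P>(\<omega> in law G. cova G \<omega> = c) > 0 \<and>
     (\<forall>a. \<P>(\<omega> in law G. expo G \<omega> = a \<bar> cova G \<omega> = c) > 0) \<and>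
     (\<forall>m. p_med G False c m > 0 \<longrightarrow> p_med G True c m > 0)"

definition mediation_model :: "('w, 'm, 'c, 'u) mediation \<Rightarrow> 'c \<Rightarrow> bool" where
  "mediation_model G c \<longleftrightarrow>
     prob_space (law G) \<and> random_variables G \<and> consistency G \<and> composition G \<and>
     no_confounding G \<and> cond_indep (law G) (expo G) (unme G) (cova G) \<and> positivity G c"

definition NIE_true :: "('w, 'm, 'c, 'u) mediation \<Rightarrow> 'c \<Rightarrow> real" where
  "NIE_true G c =
     \<P>(\<omega> in law G. Y_nested G True True \<omega> \<bar> cova G \<omega> = c) -
     \<P>(\<omega> in law G. Y_nested G True False \<omega> \<bar> cova G \<omega> = c)"

definition m_levels :: "('w, 'm, 'c, 'u) mediation \<Rightarrow> 'c \<Rightarrow> 'm set" where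
  "m_levels G c = {m. p_med G False c m > 0}"

definition u_levels :: "('w, 'm, 'c, 'u) mediation \<Rightarrow> 'c \<Rightarrow> 'u set" where
  "u_levels G c = {u. \<P>(\<omega> in law G. unme G \<omega> = u \<bar> cova G \<omega> = c) > 0}"

definition p_unme :: "('w, 'm, 'c, 'u) mediation \<Rightarrow> bool \<Rightarrow> 'm \<Rightarrow> 'c \<Rightarrow> 'u \<Rightarrow> real" where
  "p_unme G a m c u =
     \<P>(\<omega> in law G. unme G \<omega> = u \<bar> expo G \<omega> = a \<and> medi G \<omega> = m \<and> cova G \<omega> = c)"

text \<open>
  \<open>P(Y = 1 | A = a, m, c, u)\<close>, replaced by \<open>P(Y\<^sub>a\<^sub>m = 1 | c, u)\<close> if the conditioning event is null.
\<close>

definition p_outc :: "('w, 'm, 'c, 'u) mediation \<Rightarrow> bool \<Rightarrow> 'm \<Rightarrow> 'c \<Rightarrow> 'u \<Rightarrow> real" where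
  "p_outc G a m c u =
     (if \<P>(\<omega> in law G. expo G \<omega> = a \<and> medi G \<omega> = m \<and> cova G \<omega> = c \<and> unme G \<omega> = u) > 0
      then \<P>(\<omega> in law G. outc G \<omega> \<bar>
             expo G \<omega> = a \<and> medi G \<omega> = m \<and> cova G \<omega> = c \<and> unme G \<omega> = u)
      else \<P>(\<omega> in law G. Y_joint G a m \<omega> \<bar> cova G \<omega> = c \<and> unme G \<omega> = u))"

text \<open>
  The sensitivity parameters are extended reals.  Division on \<^typ>\<open>ereal\<close> satisfies
  \<open>x / 0 = \<infinity>\<close> for \<open>x > 0\<close> and \<open>x / \<infinity> = 0\<close>, as intended here; the library
  value \<open>0 / 0 = 0\<close> is never used.  The levels of \<open>m\<close> and \<open>u\<close> entering a maximum form a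
  nonempty finite set in every model satisfying \<open>mediation_model\<close>.
\<close>

definition RR_UY :: "('w, 'm::finite, 'c, 'u::finite) mediation \<Rightarrow> 'c \<Rightarrow> ereal" where
  "RR_UY G c = (MAX m\<in>m_levels G c.
     let hi = (MAX u\<in>u_levels G c. p_outc G True m c u);
         lo = (MIN u\<in>u_levels G c. p_outc G True m c u)
     in if hi = 0 \<and> lo = 0 then 1 else ereal hi / ereal lo)"

definition RR_AU :: "('w, 'm::finite, 'c, 'u::finite) mediation \<Rightarrow> 'c \<Rightarrow> ereal" where
  "RR_AU G c = (MAX m\<in>m_levels G c.
     MAX u\<in>{u \<in> u_levels G c. \<not> (p_unme G True m c u = 0 \<and> p_unme G False m c u = 0)}.
       ereal (p_unme G True m c u) / ereal (p_unme G False m c u))"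

definition bounding_factor :: "ereal \<Rightarrow> ereal \<Rightarrow> ereal" where
  "bounding_factor r s =
     (if r = \<infinity> then s else if s = \<infinity> then r else r * s / (r + s - 1))"

definition BF :: "('w, 'm::finite, 'c, 'u::finite) mediation \<Rightarrow> 'c \<Rightarrow> ereal" where
  "BF G c = bounding_factor (RR_AU G c) (RR_UY G c)"

definition NIE_bound :: "('w, 'm::finite, 'c, 'u::finite) mediation \<Rightarrow> 'c \<Rightarrow> ereal" where
  "NIE_bound G c =
     ereal \<P>(\<omega> in law G. outc G \<omega> \<bar> expo G \<omega> = True \<and> cova G \<omega> = c) -
     (\<Sum>m\<in>m_levels G c.
        ereal (\<P>(\<omega> in law G. outc G \<omega> \<bar> expo G \<omega> = True \<and> medi G \<omega> = m \<and> cova G \<omega> = c)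
               * p_med G False c m) / BF G c)"

end

theory Submission
  imports Defs
begin

text \<open>
  \<^bold>\<open>The bound.\<close>  Write \<open>y(m,u) = P(Y\<^sub>1\<^sub>m = 1 | c,u)\<close>.  The cross-world independence of
  \<open>Y\<^sub>a\<^sub>m\<close> and \<open>M\<^sub>a\<^sub>'\<close> given \<open>(C,U)\<close> factors the law of the nested outcome, and the
  unconfoundedness of \<open>M\<^sub>a\<^sub>'\<close> together with the independence of \<open>A\<close> and \<open>U\<close> turns the
  weights \<open>P(M\<^sub>a\<^sub>' = m | c,u) P(u|c)\<close> into the observable \<open>P(m,u | A = a',c)\<close>
  (\<open>mediation_formula\<close>).  Hence both counterfactual risks in the natural indirect effect are averages
  of the same function \<open>y\<close>: over \<open>P(m,u | A = 1,c)\<close>, which gives exactly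
  \<open>P(Y = 1 | A = 1,c)\<close> (\<open>observed_risk\<close>), and over \<open>P(m,u | A = 0,c)\<close>, which is not
  identified because \<open>U\<close> is unobserved.

  The second average is bounded below one mediator level at a time.  Conditioning on \<open>M = m\<close> makes
  \<open>A\<close> and \<open>U\<close> dependent, and the observed \<open>P(Y = 1 | A = 1,m,c)\<close> averages \<open>y(m,\<sqdot>)\<close>
  over \<open>P(u | A = 1,m,c)\<close> where \<open>P(u | A = 0,m,c)\<close> is wanted.  The first density is at most
  \<open>RR\<^sub>A\<^sub>U\<close> times the second and the values of \<open>y(m,\<sqdot>)\<close> lie within a factor
  \<open>RR\<^sub>U\<^sub>Y\<close> of each other.  Under these two constraints the ratio of the means is at most the
  bounding factor (\<open>bounding_inequality\<close>, \<open>bounded_ratio_of_means\<close>).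

  \<^bold>\<open>Sharpness.\<close>  For \<open>\<gamma> > 1\<close> both constraints are exhausted when, at every mediator
  level that occurs without exposure, \<open>P(u | A = 1,m,c)\<close> sits on a level of \<open>U\<close> with the
  highest risk, while \<open>P(u | A = 0,m,c)\<close> gives that level mass \<open>1/\<gamma>\<close> and the lowest risk
  to the rest.  With \<open>A\<close> and \<open>U\<close>
  independent, such a shift has to come from selection by the mediator.  So let unexposed units always
  have \<open>M = 1\<close>, and exposed units \<open>M = U\<close>: the stratum \<open>M = 1\<close> then selects \<open>U = 1\<close>
  among the exposed and nothing among the unexposed, and no other stratum enters the bound.  The outcome
  depends on \<open>U\<close> and an independent coin only, so that the true effect is zero, and the bound is
  seen to be zero as well (\<open>bound_attained\<close>).
\<close>

section \<open>Means of one function under two densities\<close>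

text \<open>
  Subtract the lower bound \<open>l\<close> from \<open>y\<close> and let \<open>e0\<close>, \<open>e1\<close> be the two means of the
  excess.  Domination of the densities gives \<open>e1 \<le> r e0\<close>, and the range of \<open>y\<close> gives
  \<open>e1 \<le> (s - 1) l\<close>.  The difference of the two sides is a combination of these two slacks with
  the nonnegative coefficients \<open>s\<close> and \<open>r - 1\<close>, which also shows when equality holds.
\<close>

lemma bounding_inequality:
  fixes f0 f1 y :: "'u \<Rightarrow> real"
  assumes f0: "\<And>u. u \<in> S \<Longrightarrow> 0 \<le> f0 u" "sum f0 S = 1"
    and f1: "\<And>u. u \<in> S \<Longrightarrow> 0 \<le> f1 u" "sum f1 S = 1"
    and s: "0 \<le> s" and r: "1 \<le> r" "\<And>u. u \<in> S \<Longrightarrow> f1 u \<le> r * f0 u"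
    and y: "\<And>u. u \<in> S \<Longrightarrow> l \<le> y u" "\<And>u. u \<in> S \<Longrightarrow> y u \<le> s * l"
  shows "(\<Sum>u\<in>S. y u * f1 u) * (r + s - 1) \<le> r * s * (\<Sum>u\<in>S. y u * f0 u)"
proof -
  define e0 where "e0 = (\<Sum>u\<in>S. (y u - l) * f0 u)"
  define e1 where "e1 = (\<Sum>u\<in>S. (y u - l) * f1 u)"
  have E0: "(\<Sum>u\<in>S. y u * f0 u) = l + e0"
    unfolding e0_def left_diff_distrib sum_subtractf sum_distrib_left[symmetric] f0(2) by simp
  have E1: "(\<Sum>u\<in>S. y u * f1 u) = l + e1"
    unfolding e1_def left_diff_distrib sum_subtractf sum_distrib_left[symmetric] f1(2) by simp
  have "e1 \<le> (\<Sum>u\<in>S. (y u - l) * (r * f0 u))"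
    unfolding e1_def using y(1) r(2) by (intro sum_mono mult_left_mono) auto
  also have "\<dots> = r * e0"
    by (simp add: e0_def sum_distrib_left mult_ac)
  finally have tilt: "e1 \<le> r * e0" .
  have "e1 \<le> (\<Sum>u\<in>S. (s * l - l) * f1 u)"
    unfolding e1_def using y(2) f1(1) by (intro sum_mono mult_right_mono) auto
  also have "\<dots> = s * l - l"
    using f1(2) by (simp add: sum_distrib_left[symmetric])
  finally have range: "e1 \<le> s * l - l" .
  have "0 \<le> s * (r * e0 - e1) + (r - 1) * ((s * l - l) - e1)"
    using tilt range r(1) s by simp
  then show ?thesis
    unfolding E0 E1 by (simp add: algebra_simps)
qed

text \<open>
  An infinite parameter imposes no constraint, which is why the two constraints below are
  stated for finite values only.  With one of them missing the other still bounds the ratio of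
  the means, in agreement with the value of the bounding factor there.
\<close>

lemma bounded_ratio_of_means:
  fixes f0 f1 y :: "'u \<Rightarrow> real" and R B :: ereal
  assumes fin: "finite S"
    and f0: "\<And>u. u \<in> S \<Longrightarrow> 0 \<le> f0 u" "sum f0 S = 1"
    and f1: "\<And>u. u \<in> S \<Longrightarrow> 0 \<le> f1 u" "sum f1 S = 1"
    and y0: "\<And>u. u \<in> S \<Longrightarrow> 0 \<le> y u"
    and R: "R \<noteq> - \<infinity>" "\<And>r u. R = ereal r \<Longrightarrow> u \<in> S \<Longrightarrow> f1 u \<le> r * f0 u"
    and B: "1 \<le> B" "\<And>s u v. B = ereal s \<Longrightarrow> u \<in> S \<Longrightarrow> v \<in> S \<Longrightarrow> y u \<le> s * y v"
  shows "ereal (\<Sum>u\<in>S. y u * f1 u) / bounding_factor R B \<le> ereal (\<Sum>u\<in>S. y u * f0 u)"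
proof -
  define E0 E1 where "E0 = (\<Sum>u\<in>S. y u * f0 u)" and "E1 = (\<Sum>u\<in>S. y u * f1 u)"
  have E0_nonneg: "0 \<le> E0"
    unfolding E0_def using y0 f0(1) by (intro sum_nonneg mult_nonneg_nonneg)
  have ne: "S \<noteq> {}" using f0(2) by auto
  define l where "l = Min (y ` S)"
  have l_le: "l \<le> y u" if "u \<in> S" for u
    using that fin by (simp add: l_def)
  obtain v where v: "v \<in> S" "l = y v"
    using Min_in[of "y ` S"] fin ne unfolding l_def by blast
  have r1: "1 \<le> r" if "R = ereal r" for r
  proof -
    have "sum f1 S \<le> (\<Sum>u\<in>S. r * f0 u)" using R(2)[OF that] by (rule sum_mono)
    then show ?thesis using f0(2) f1(2) by (simp add: sum_distrib_left[symmetric])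
  qed
  have "ereal E1 / bounding_factor R B \<le> ereal E0"
  proof (cases R)
    case (real r)
    note r = r1[OF real] R(2)[OF real]
    show ?thesis
    proof (cases B)
      case (real s)
      then have s1: "1 \<le> s" using B(1) by simp
      have "E1 * (r + s - 1) \<le> r * s * E0"
        unfolding E0_def E1_def
      proof (rule bounding_inequality[OF f0 f1 _ r])
        show "y u \<le> s * l" if "u \<in> S" for u using B(2)[OF real that v(1)] v(2) by simp
      qed (use l_le s1 in auto)
      then have "E1 / (r * s / (r + s - 1)) \<le> E0"
        using r(1) s1 by (simp add: pos_divide_le_eq mult_ac)
      moreover have "r * s / (r + s - 1) \<noteq> 0"
        using r(1) s1 by simp
      ultimately show ?thesis
        using r(1) s1 real \<open>R = ereal r\<close> by (simp add: bounding_factor_def one_ereal_def)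
    next
      case PInf
      have "E1 \<le> (\<Sum>u\<in>S. y u * (r * f0 u))"
        unfolding E1_def using y0 r(2) by (intro sum_mono mult_left_mono) auto
      also have "\<dots> = r * E0" by (simp add: E0_def sum_distrib_left mult_ac)
      finally show ?thesis
        using r(1) PInf real by (simp add: bounding_factor_def pos_divide_le_eq mult_ac)
    qed (use B(1) in auto)
  next
    case PInf
    show ?thesis
    proof (cases B)
      case (real s)
      then have s1: "1 \<le> s" using B(1) by simp
      have "E1 \<le> (\<Sum>u\<in>S. s * l * f1 u)"
        unfolding E1_def using B(2)[OF real _ v(1)] v(2) f1(1)
        by (intro sum_mono mult_right_mono) auto
      also have "\<dots> = s * l" using f1(2) by (simp add: sum_distrib_left[symmetric])
      also have "l = (\<Sum>u\<in>S. l * f0 u)" using f0(2) by (simp add: sum_distrib_left[symmetric])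
      also have "\<dots> \<le> E0"
        unfolding E0_def using l_le f0(1) by (intro sum_mono mult_right_mono) auto
      finally show ?thesis
        using s1 PInf real by (simp add: bounding_factor_def pos_divide_le_eq mult_ac)
    next
      case PInf
      then show ?thesis using E0_nonneg \<open>R = \<infinity>\<close> by (simp add: bounding_factor_def)
    qed (use B(1) in auto)
  qed (use R(1) in auto)
  then show ?thesis by (simp add: E0_def E1_def)
qed

section \<open>Conditional independence without division\<close>

text \<open>
  Multiplying out the conditional probabilities also covers null levels of \<open>Z\<close>, where
  both sides vanish.
\<close>

lemma (in finite_measure) cond_indep_product:
  assumes "cond_indep M X Y Z" and meas: "{\<omega> \<in> space M. Z \<omega> = z} \<in> sets M"
  shows "\<P>(\<omega> in M. X \<omega> = x \<and> Y \<omega> = y \<and> Z \<omega> = z) * \<P>(\<omega> in M. Z \<omega> = z) =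
    \<P>(\<omega> in M. X \<omega> = x \<and> Z \<omega> = z) * \<P>(\<omega> in M. Y \<omega> = y \<and> Z \<omega> = z)"
proof (cases "\<P>(\<omega> in M. Z \<omega> = z) > 0")
  case True
  then show ?thesis
    using assms(1) unfolding cond_indep_def cond_prob_def
    by (auto simp: field_simps conj_assoc)
next
  case False
  then have Z0: "\<P>(\<omega> in M. Z \<omega> = z) = 0"
    using measure_nonneg by (metis less_eq_real_def)
  have "\<P>(\<omega> in M. X \<omega> = x \<and> Z \<omega> = z) \<le> \<P>(\<omega> in M. Z \<omega> = z)"
    using meas by (intro finite_measure_mono) auto
  then have "\<P>(\<omega> in M. X \<omega> = x \<and> Z \<omega> = z) = 0"
    using Z0 by (simp add: measure_le_0_iff)
  with Z0 show ?thesis by simp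
qed

lemma (in finite_measure) prob_split_finite:
  fixes X :: "'a \<Rightarrow> 'x::finite"
  assumes X: "X \<in> measurable M (count_space UNIV)" and P: "Measurable.pred M P"
  shows "\<P>(\<omega> in M. P \<omega>) = (\<Sum>x\<in>UNIV. \<P>(\<omega> in M. P \<omega> \<and> X \<omega> = x))"
proof -
  have "{\<omega> \<in> space M. P \<omega>} = (\<Union>x\<in>UNIV. {\<omega> \<in> space M. P \<omega> \<and> X \<omega> = x})" by auto
  moreover have "measure M (\<Union>x\<in>UNIV. {\<omega> \<in> space M. P \<omega> \<and> X \<omega> = x}) =
    (\<Sum>x\<in>UNIV. \<P>(\<omega> in M. P \<omega> \<and> X \<omega> = x))"
  proof (rule finite_measure_finite_Union)
    show "(\<lambda>x. {\<omega> \<in> space M. P \<omega> \<and> X \<omega> = x}) ` UNIV \<subseteq> sets M"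
      using X P by auto
    show "disjoint_family_on (\<lambda>x. {\<omega> \<in> space M. P \<omega> \<and> X \<omega> = x}) UNIV"
      by (auto simp: disjoint_family_on_def)
  qed simp
  ultimately show ?thesis by simp
qed

lemma cond_indep_commute: "cond_indep Q Y X Z \<Longrightarrow> cond_indep Q X Y Z"
  by (simp add: cond_indep_def conj_commute conj_left_commute mult.commute)

lemma cond_indep_of_determined:
  assumes "\<And>\<omega>. Y \<omega> = h (Z \<omega>)"
  shows "cond_indep (measure_pmf Q) X Y Z"
  unfolding cond_indep_def cond_prob_def
proof (intro allI impI)
  fix x y z assume "0 < \<P>(\<omega> in measure_pmf Q. Z \<omega> = z)"
  moreover have "{\<omega> \<in> space (measure_pmf Q). Y \<omega> = y \<and> Z \<omega> = z} =
     (if y = h z then {\<omega> \<in> space (measure_pmf Q). Z \<omega> = z} else {})"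
    "{\<omega> \<in> space (measure_pmf Q). (X \<omega> = x \<and> Y \<omega> = y) \<and> Z \<omega> = z} =
     (if y = h z then {\<omega> \<in> space (measure_pmf Q). X \<omega> = x \<and> Z \<omega> = z} else {})"
    using assms by auto
  ultimately show "\<P>(\<omega> in measure_pmf Q. (X \<omega> = x \<and> Y \<omega> = y) \<and> Z \<omega> = z) / \<P>(\<omega> in measure_pmf Q. Z \<omega> = z) =
     \<P>(\<omega> in measure_pmf Q. X \<omega> = x \<and> Z \<omega> = z) / \<P>(\<omega> in measure_pmf Q. Z \<omega> = z) *
     (\<P>(\<omega> in measure_pmf Q. Y \<omega> = y \<and> Z \<omega> = z) / \<P>(\<omega> in measure_pmf Q. Z \<omega> = z))"
    by simp
qed

section \<open>Identification of the counterfactual risks\<close>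

locale mediation_setting =
  fixes G :: "('w, 'm::finite, 'c::finite, 'u::finite) mediation" and c :: 'c
  assumes model: "mediation_model G c"
begin

sublocale prob_space "law G"
  using model by (simp add: mediation_model_def)

lemma measurable_rvs [measurable]:
  "expo G \<in> measurable (law G) (count_space UNIV)"
  "outc G \<in> measurable (law G) (count_space UNIV)"
  "medi G \<in> measurable (law G) (count_space UNIV)"
  "cova G \<in> measurable (law G) (count_space UNIV)"
  "unme G \<in> measurable (law G) (count_space UNIV)"
  "M_pot G a \<in> measurable (law G) (count_space UNIV)"
  "Y_joint G a m \<in> measurable (law G) (count_space UNIV)"
  using model by (auto simp: mediation_model_def random_variables_def)

lemma measurable_Y_nested [measurable]: "Measurable.pred (law G) (Y_nested G a a')"
proof -
  have "Y_nested G a a' = (\<lambda>\<omega>. \<exists>m. M_pot G a' \<omega> = m \<and> Y_joint G a m \<omega>)"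
    by (auto simp: Y_nested_def fun_eq_iff)
  then show ?thesis by simp
qed

text \<open>
  The identities below weight \<open>risk\<close>, the conditional probability \<open>y\<close> of the introduction,
  by unconditional joint masses.  In a null stratum both sides then vanish, whatever value the
  conditional probability takes there.
\<close>

definition mass_C :: real where "mass_C = \<P>(\<omega> in law G. cova G \<omega> = c)"
definition mass_AC :: "bool \<Rightarrow> real" where "mass_AC a = \<P>(\<omega> in law G. expo G \<omega> = a \<and> cova G \<omega> = c)"
definition mass_CU where "mass_CU u = \<P>(\<omega> in law G. cova G \<omega> = c \<and> unme G \<omega> = u)"
definition mass_ACU where
  "mass_ACU a u = \<P>(\<omega> in law G. expo G \<omega> = a \<and> cova G \<omega> = c \<and> unme G \<omega> = u)"
definition mass_AMC where
  "mass_AMC a m = \<P>(\<omega> in law G. expo G \<omega> = a \<and> medi G \<omega> = m \<and> cova G \<omega> = c)"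
definition mass_AMCU where
  "mass_AMCU a m u =
    \<P>(\<omega> in law G. expo G \<omega> = a \<and> medi G \<omega> = m \<and> cova G \<omega> = c \<and> unme G \<omega> = u)"
definition risk where
  "risk a m u = \<P>(\<omega> in law G. Y_joint G a m \<omega> \<bar> cova G \<omega> = c \<and> unme G \<omega> = u)"

lemma mass_C_pos: "mass_C > 0"
  using model by (simp add: mediation_model_def positivity_def mass_C_def)

lemma mass_AC_pos: "mass_AC a > 0"
proof -
  have "\<P>(\<omega> in law G. expo G \<omega> = a \<bar> cova G \<omega> = c) > 0"
    using model by (auto simp: mediation_model_def positivity_def)
  then show ?thesis using mass_C_pos by (simp add: cond_prob_def mass_AC_def mass_C_def zero_less_divide_iff)
qed

lemma mass_ACU: "mass_ACU a u * mass_C = mass_AC a * mass_CU u"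
proof -
  have "cond_indep (law G) (expo G) (unme G) (cova G)"
    using model by (simp add: mediation_model_def)
  from cond_indep_product[OF this, of c a u, simplified] show ?thesis
    by (simp add: mass_ACU_def mass_C_def mass_AC_def mass_CU_def conj_ac)
qed

text \<open>
  The cross-world assumption enters here: no single unit reveals both \<open>Y\<^sub>a\<^sub>m\<close> and
  \<open>M\<^sub>a\<^sub>'\<close> for \<open>a' \<noteq> a\<close>, so their joint law has to be assumed to factor.
\<close>

lemma Y_joint_indep_M_pot:
  "\<P>(\<omega> in law G. Y_joint G a m \<omega> \<and> M_pot G a' \<omega> = m' \<and> cova G \<omega> = c \<and> unme G \<omega> = u) =
   risk a m u * \<P>(\<omega> in law G. M_pot G a' \<omega> = m' \<and> cova G \<omega> = c \<and> unme G \<omega> = u)"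
  (is "?j = _ * ?mm")
proof (cases "mass_CU u = 0")
  case True
  have "?j \<le> mass_CU u" "?mm \<le> mass_CU u"
    unfolding mass_CU_def by (auto intro!: finite_measure_mono)
  then show ?thesis using True by (simp add: measure_le_0_iff)
next
  case False
  have "cond_indep (law G) (Y_joint G a m) (M_pot G a') (\<lambda>\<omega>. (cova G \<omega>, unme G \<omega>))"
    using model by (simp add: mediation_model_def no_confounding_def)
  from cond_indep_product[OF this, of "(c, u)" True m']
  show ?thesis using False by (simp add: risk_def mass_CU_def cond_prob_def field_simps)
qed

text \<open>
  Given \<open>(C,U)\<close> the potential mediator is independent of \<open>A\<close>, so it may be observed in
  the arm \<open>A = a\<close>; that restricting to this arm leaves the law of \<open>U\<close> unchanged is the
  independence of \<open>A\<close> and \<open>U\<close>.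
\<close>

lemma M_pot_mass:
  "\<P>(\<omega> in law G. M_pot G a \<omega> = m \<and> cova G \<omega> = c \<and> unme G \<omega> = u) / mass_C =
   mass_AMCU a m u / mass_AC a"
  (is "?mm / _ = _")
proof (cases "mass_CU u = 0")
  case True
  have "?mm \<le> mass_CU u" "mass_AMCU a m u \<le> mass_CU u"
    unfolding mass_CU_def mass_AMCU_def by (auto intro!: finite_measure_mono)
  then show ?thesis using True by (simp add: measure_le_0_iff mass_AMCU_def)
next
  case False
  have "cond_indep (law G) (M_pot G a) (expo G) (\<lambda>\<omega>. (cova G \<omega>, unme G \<omega>))"
    using model by (simp add: mediation_model_def no_confounding_def)
  from cond_indep_product[OF this, of "(c, u)" m a]
  have "\<P>(\<omega> in law G. M_pot G a \<omega> = m \<and> expo G \<omega> = a \<and> cova G \<omega> = c \<and> unme G \<omega> = u) * mass_CU u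
     = ?mm * mass_ACU a u"
    by (simp add: mass_CU_def mass_ACU_def)
  moreover have "{\<omega> \<in> space (law G). M_pot G a \<omega> = m \<and> expo G \<omega> = a \<and> cova G \<omega> = c \<and> unme G \<omega> = u}
     = {\<omega> \<in> space (law G). expo G \<omega> = a \<and> medi G \<omega> = m \<and> cova G \<omega> = c \<and> unme G \<omega> = u}"
    using model by (auto simp: mediation_model_def consistency_def)
  ultimately have *: "mass_AMCU a m u * mass_CU u = ?mm * mass_ACU a u"
    by (simp add: mass_AMCU_def)
  have "mass_AMCU a m u * mass_C * mass_CU u = ?mm * mass_AC a * mass_CU u"
    using * mass_ACU[of a u] by algebra
  then have "mass_AMCU a m u * mass_C = ?mm * mass_AC a" using False by simp
  then show ?thesis using mass_C_pos mass_AC_pos[of a] by (simp add: field_simps)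
qed

text \<open>
  Splitting the nested outcome according to the value of \<open>M\<^sub>a\<^sub>'\<close> replaces it by \<open>Y\<^sub>a\<^sub>m\<close>
  with a fixed \<open>m\<close>; the previous two lemmas then apply to each piece.
\<close>

lemma mediation_formula:
  "\<P>(\<omega> in law G. Y_nested G a a' \<omega> \<bar> cova G \<omega> = c) =
   (\<Sum>m\<in>UNIV. \<Sum>u\<in>UNIV. risk a m u * mass_AMCU a' m u) / mass_AC a'"
proof -
  have "\<P>(\<omega> in law G. Y_nested G a a' \<omega> \<and> cova G \<omega> = c) =
    (\<Sum>m\<in>UNIV. \<P>(\<omega> in law G. (Y_nested G a a' \<omega> \<and> cova G \<omega> = c) \<and> M_pot G a' \<omega> = m))"
    by (rule prob_split_finite) measurable
  also have "\<dots> = (\<Sum>m\<in>UNIV. \<Sum>u\<in>UNIV.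
     \<P>(\<omega> in law G. ((Y_nested G a a' \<omega> \<and> cova G \<omega> = c) \<and> M_pot G a' \<omega> = m) \<and> unme G \<omega> = u))"
    by (intro sum.cong refl prob_split_finite) measurable
  also have "\<dots> = (\<Sum>m\<in>UNIV. \<Sum>u\<in>UNIV. \<P>(\<omega> in law G.
      Y_joint G a m \<omega> \<and> M_pot G a' \<omega> = m \<and> cova G \<omega> = c \<and> unme G \<omega> = u))"
    by (intro sum.cong refl arg_cong[where f = "measure (law G)"]) (auto simp: Y_nested_def)
  also have "\<dots> / mass_C = (\<Sum>m\<in>UNIV. \<Sum>u\<in>UNIV. risk a m u * mass_AMCU a' m u / mass_AC a')"
    unfolding Y_joint_indep_M_pot sum_divide_distrib times_divide_eq_right[symmetric] M_pot_mass ..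
  finally show ?thesis by (simp add: cond_prob_def mass_C_def sum_divide_distrib)
qed

text \<open>
  On \<open>A = a, M = m\<close> the outcome is \<open>Y\<^sub>a\<^sub>m\<close>.  Independence from \<open>M\<close> given \<open>(A,C,U)\<close>
  and then from \<open>A\<close> given \<open>(C,U)\<close> removes both conditions.
\<close>

lemma risk_identified:
  "risk a m u * mass_AMCU a m u =
   \<P>(\<omega> in law G. outc G \<omega> \<and> expo G \<omega> = a \<and> medi G \<omega> = m \<and> cova G \<omega> = c \<and> unme G \<omega> = u)"
  (is "_ = ?o")
proof (cases "mass_AMCU a m u = 0")
  case True
  have "?o \<le> mass_AMCU a m u"
    unfolding mass_AMCU_def by (auto intro!: finite_measure_mono)
  then show ?thesis using True by (simp add: measure_le_0_iff)
next
  case False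
  have "mass_AMCU a m u \<le> mass_ACU a u" "mass_ACU a u \<le> mass_CU u"
    unfolding mass_AMCU_def mass_ACU_def mass_CU_def by (auto intro!: finite_measure_mono)
  moreover have "mass_AMCU a m u > 0"
    using False by (simp add: mass_AMCU_def zero_less_measure_iff)
  ultimately have pos: "mass_ACU a u \<noteq> 0" "mass_CU u \<noteq> 0" by auto
  have "cond_indep (law G) (Y_joint G a m) (medi G) (\<lambda>\<omega>. (expo G \<omega>, cova G \<omega>, unme G \<omega>))"
    using model by (simp add: mediation_model_def no_confounding_def)
  from cond_indep_product[OF this, of "(a, c, u)" True m, simplified]
  have "\<P>(\<omega> in law G. Y_joint G a m \<omega> \<and> medi G \<omega> = m \<and> expo G \<omega> = a \<and> cova G \<omega> = c \<and> unme G \<omega> = u)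
      * mass_ACU a u =
    \<P>(\<omega> in law G. Y_joint G a m \<omega> \<and> expo G \<omega> = a \<and> cova G \<omega> = c \<and> unme G \<omega> = u) * mass_AMCU a m u"
    by (simp add: mass_ACU_def mass_AMCU_def conj_left_commute)
  moreover have "{\<omega> \<in> space (law G). Y_joint G a m \<omega> \<and> medi G \<omega> = m \<and> expo G \<omega> = a \<and> cova G \<omega> = c \<and> unme G \<omega> = u}
     = {\<omega> \<in> space (law G). outc G \<omega> \<and> expo G \<omega> = a \<and> medi G \<omega> = m \<and> cova G \<omega> = c \<and> unme G \<omega> = u}"
    using model by (auto simp: mediation_model_def consistency_def)
  ultimately have 1: "?o * mass_ACU a u =
    \<P>(\<omega> in law G. Y_joint G a m \<omega> \<and> expo G \<omega> = a \<and> cova G \<omega> = c \<and> unme G \<omega> = u) * mass_AMCU a m u"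
    by simp
  have "cond_indep (law G) (Y_joint G a m) (expo G) (\<lambda>\<omega>. (cova G \<omega>, unme G \<omega>))"
    using model by (simp add: mediation_model_def no_confounding_def)
  from cond_indep_product[OF this, of "(c, u)" True a]
  have "\<P>(\<omega> in law G. Y_joint G a m \<omega> \<and> expo G \<omega> = a \<and> cova G \<omega> = c \<and> unme G \<omega> = u) * mass_CU u =
    (risk a m u * mass_CU u) * mass_ACU a u"
    using pos by (simp add: mass_ACU_def mass_CU_def risk_def cond_prob_def)
  then have "\<P>(\<omega> in law G. Y_joint G a m \<omega> \<and> expo G \<omega> = a \<and> cova G \<omega> = c \<and> unme G \<omega> = u) =
    risk a m u * mass_ACU a u"
    using pos by simp
  with 1 show ?thesis using pos by simp
qed

lemma p_outc_eq_risk: "p_outc G a m c u = risk a m u"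
  using risk_identified[of a m u]
  by (simp add: p_outc_def risk_def mass_AMCU_def cond_prob_def field_simps)

lemma observed_risk_in_stratum:
  "\<P>(\<omega> in law G. outc G \<omega> \<and> expo G \<omega> = a \<and> medi G \<omega> = m \<and> cova G \<omega> = c) =
   (\<Sum>u\<in>UNIV. risk a m u * mass_AMCU a m u)"
proof -
  have "\<P>(\<omega> in law G. outc G \<omega> \<and> expo G \<omega> = a \<and> medi G \<omega> = m \<and> cova G \<omega> = c) =
    (\<Sum>u\<in>UNIV. \<P>(\<omega> in law G. (outc G \<omega> \<and> expo G \<omega> = a \<and> medi G \<omega> = m \<and> cova G \<omega> = c) \<and> unme G \<omega> = u))"
    by (rule prob_split_finite) measurable
  then show ?thesis by (simp add: risk_identified)
qed

text \<open>
  For equal exposures the weights of the mediation formula come from the same arm as the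
  outcome, so each summand is the mass of an observable event.
\<close>

lemma observed_risk:
  "\<P>(\<omega> in law G. Y_nested G a a \<omega> \<bar> cova G \<omega> = c) =
   \<P>(\<omega> in law G. outc G \<omega> \<bar> expo G \<omega> = a \<and> cova G \<omega> = c)"
proof -
  have "\<P>(\<omega> in law G. outc G \<omega> \<and> expo G \<omega> = a \<and> cova G \<omega> = c) =
    (\<Sum>m\<in>UNIV. \<P>(\<omega> in law G. (outc G \<omega> \<and> expo G \<omega> = a \<and> cova G \<omega> = c) \<and> medi G \<omega> = m))"
    by (rule prob_split_finite) measurable
  also have "\<dots> = (\<Sum>m\<in>UNIV. \<Sum>u\<in>UNIV. risk a m u * mass_AMCU a m u)"
    unfolding observed_risk_in_stratum[symmetric]
    by (intro sum.cong refl arg_cong[where f = "measure (law G)"]) auto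
  finally show ?thesis unfolding mediation_formula by (simp add: cond_prob_def mass_AC_def)
qed

lemma p_med_eq: "p_med G a c m = mass_AMC a m / mass_AC a"
  by (simp add: p_med_def cond_prob_def mass_AMC_def mass_AC_def conj_ac)

lemma p_unme_eq: "p_unme G a m c u = mass_AMCU a m u / mass_AMC a m"
  by (simp add: p_unme_def cond_prob_def mass_AMC_def mass_AMCU_def conj_ac)

lemma u_levels_eq: "u_levels G c = {u. mass_CU u > 0}"
  using mass_C_pos
  by (simp add: u_levels_def cond_prob_def mass_C_def mass_CU_def zero_less_divide_iff conj_commute)

text \<open>
  The sensitivity parameters range only over levels of \<open>U\<close> with positive probability.  The
  other levels carry no mass in any stratum, so sums over \<open>u\<close> may be restricted.
\<close>

lemma mass_AMCU_outside: "u \<notin> u_levels G c \<Longrightarrow> mass_AMCU a m u = 0"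
proof -
  assume "u \<notin> u_levels G c"
  moreover have "mass_AMCU a m u \<le> mass_CU u"
    unfolding mass_AMCU_def mass_CU_def by (auto intro!: finite_measure_mono)
  ultimately show ?thesis
    by (simp add: u_levels_eq mass_AMCU_def mass_CU_def measure_le_0_iff zero_less_measure_iff)
qed

lemma sum_u_levels:
  "(\<Sum>u\<in>UNIV. h u * mass_AMCU a m u) = (\<Sum>u\<in>u_levels G c. h u * mass_AMCU a m u)"
  by (rule sum.mono_neutral_right) (auto simp: mass_AMCU_outside)

lemma mass_AMC_sum: "mass_AMC a m = (\<Sum>u\<in>u_levels G c. mass_AMCU a m u)"
proof -
  have "mass_AMC a m = (\<Sum>u\<in>UNIV. \<P>(\<omega> in law G. (expo G \<omega> = a \<and> medi G \<omega> = m \<and> cova G \<omega> = c) \<and> unme G \<omega> = u))"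
    unfolding mass_AMC_def by (rule prob_split_finite) measurable
  also have "\<dots> = (\<Sum>u\<in>UNIV. 1 * mass_AMCU a m u)" by (simp add: mass_AMCU_def)
  finally show ?thesis unfolding sum_u_levels by simp
qed

lemma mass_AMC_pos: "m \<in> m_levels G c \<Longrightarrow> mass_AMC a m > 0"
proof -
  assume m: "m \<in> m_levels G c"
  then have "p_med G a c m > 0"
    using model by (cases a) (auto simp: m_levels_def mediation_model_def positivity_def)
  then show ?thesis using mass_AC_pos[of a] by (simp add: p_med_eq zero_less_divide_iff)
qed

lemma p_unme_nonneg: "0 \<le> p_unme G a m c u"
  by (simp add: p_unme_def cond_prob_def)

lemma p_unme_sum: "m \<in> m_levels G c \<Longrightarrow> (\<Sum>u\<in>u_levels G c. p_unme G a m c u) = 1"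
  using mass_AMC_pos[of m a] by (simp add: p_unme_eq sum_divide_distrib[symmetric] mass_AMC_sum)

lemma risk_nonneg: "0 \<le> risk a m u"
  by (simp add: risk_def cond_prob_def)

section \<open>The bound\<close>

lemma RR_AU_upper:
  assumes "m \<in> m_levels G c" "u \<in> u_levels G c"
    "\<not> (p_unme G True m c u = 0 \<and> p_unme G False m c u = 0)"
  shows "ereal (p_unme G True m c u) / ereal (p_unme G False m c u) \<le> RR_AU G c"
proof -
  let ?g = "\<lambda>m. MAX u\<in>{u \<in> u_levels G c. \<not> (p_unme G True m c u = 0 \<and> p_unme G False m c u = 0)}.
       ereal (p_unme G True m c u) / ereal (p_unme G False m c u)"
  have "ereal (p_unme G True m c u) / ereal (p_unme G False m c u) \<le> ?g m"
    using assms by (intro Max_ge) auto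
  also have "\<dots> \<le> RR_AU G c"
    unfolding RR_AU_def using assms by (intro Max_ge) auto
  finally show ?thesis .
qed

lemma RR_AU_not_MInf: assumes "m \<in> m_levels G c" shows "RR_AU G c \<noteq> - \<infinity>"
proof -
  have "\<exists>u\<in>u_levels G c. p_unme G False m c u \<noteq> 0"
    using p_unme_sum[OF assms, of False] by (metis sum.neutral zero_neq_one)
  then obtain u where u: "u \<in> u_levels G c" "p_unme G False m c u \<noteq> 0" by blast
  then show ?thesis using RR_AU_upper[OF assms u(1)] by auto
qed

text \<open>
  If \<open>P(u | A = 0,m,c) = 0 < P(u | A = 1,m,c)\<close>, the ratio is infinite.  Clearing the
  denominator is therefore legitimate at null levels too, as long as the parameter is finite.
\<close>

lemma RR_AU_tilt:
  assumes "m \<in> m_levels G c" "u \<in> u_levels G c" "RR_AU G c = ereal r"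
  shows "p_unme G True m c u \<le> r * p_unme G False m c u"
proof (cases "p_unme G True m c u = 0 \<and> p_unme G False m c u = 0")
  case False
  note up = RR_AU_upper[OF assms(1,2) False, unfolded assms(3)]
  show ?thesis
  proof (cases "p_unme G False m c u = 0")
    case True
    then have "p_unme G True m c u > 0" using False p_unme_nonneg[of True m u] by simp
    with up True show ?thesis by simp
  next
    case f: False
    then have "p_unme G False m c u > 0" using p_unme_nonneg[of False m u] by simp
    with up show ?thesis by (simp add: pos_divide_le_eq)
  qed
qed simp

lemma RR_UY_upper:
  assumes m: "m \<in> m_levels G c"
  defines "hi \<equiv> MAX u\<in>u_levels G c. risk True m u" and "lo \<equiv> MIN u\<in>u_levels G c. risk True m u"
  shows "(if hi = 0 \<and> lo = 0 then 1 else ereal hi / ereal lo) \<le> RR_UY G c"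
  unfolding RR_UY_def using m
  by (intro Max_ge) (auto simp: p_outc_eq_risk hi_def lo_def Let_def image_iff)

lemma risk_range:
  assumes m: "m \<in> m_levels G c"
  shows "1 \<le> RR_UY G c"
    and "\<And>s u v. \<lbrakk>RR_UY G c = ereal s; u \<in> u_levels G c; v \<in> u_levels G c\<rbrakk>
      \<Longrightarrow> risk True m u \<le> s * risk True m v"
proof -
  define hi lo where "hi = (MAX u\<in>u_levels G c. risk True m u)"
    and "lo = (MIN u\<in>u_levels G c. risk True m u)"
  have up: "(if hi = 0 \<and> lo = 0 then 1 else ereal hi / ereal lo) \<le> RR_UY G c"
    unfolding hi_def lo_def by (rule RR_UY_upper[OF m])
  have hi: "risk True m u \<le> hi" and lo: "lo \<le> risk True m u" if "u \<in> u_levels G c" for u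
    using that by (auto simp: hi_def lo_def)
  have ne: "u_levels G c \<noteq> {}" using p_unme_sum[OF m, of True] by auto
  then have lo0: "0 \<le> lo" by (simp add: lo_def risk_nonneg)
  have lohi: "lo \<le> hi" using ne hi lo by force
  have ratio: "1 \<le> ereal hi / ereal lo" if "\<not> (hi = 0 \<and> lo = 0)"
    using that lo0 lohi by (cases "lo = 0") (auto simp: one_ereal_def)
  show "1 \<le> RR_UY G c"
    using up ratio by (auto split: if_splits intro: order_trans)
  show "risk True m u \<le> s * risk True m v"
    if s: "RR_UY G c = ereal s" and u: "u \<in> u_levels G c" and v: "v \<in> u_levels G c" for s u v
  proof (cases "hi = 0")
    case True
    then show ?thesis using hi[OF u] hi[OF v] risk_nonneg[of True m u] risk_nonneg[of True m v] by simp
  next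
    case False
    have "lo \<noteq> 0"
      using False up s lohi lo0 by auto
    then have "hi \<le> s * lo" using up s lo0 False by (simp add: pos_divide_le_eq)
    moreover have "s \<ge> 1" using \<open>1 \<le> RR_UY G c\<close> s by simp
    then have "s * lo \<le> s * risk True m v" using lo[OF v] by simp
    ultimately show ?thesis using hi[OF u] by simp
  qed
qed

text \<open>
  The right-hand side is the contribution of \<open>m\<close> to \<open>P(Y\<^sub>1\<^sub>M\<^sub>0 = 1 | c)\<close> in the mediation
  formula.
\<close>

lemma stratum_bound:
  assumes m: "m \<in> m_levels G c"
  shows "ereal (\<P>(\<omega> in law G. outc G \<omega> \<bar> expo G \<omega> = True \<and> medi G \<omega> = m \<and> cova G \<omega> = c)
            * p_med G False c m) / BF G c
    \<le> ereal ((\<Sum>u\<in>UNIV. risk True m u * mass_AMCU False m u) / mass_AC False)"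
proof -
  have mean1: "\<P>(\<omega> in law G. outc G \<omega> \<bar> expo G \<omega> = True \<and> medi G \<omega> = m \<and> cova G \<omega> = c) =
    (\<Sum>u\<in>u_levels G c. risk True m u * p_unme G True m c u)"
    using observed_risk_in_stratum[of True m]
    by (simp add: cond_prob_def sum_u_levels p_unme_eq sum_divide_distrib mass_AMC_def)
  have mean0: "(\<Sum>u\<in>UNIV. risk True m u * mass_AMCU False m u) / mass_AC False =
    (\<Sum>u\<in>u_levels G c. risk True m u * p_unme G False m c u) * p_med G False c m"
    using mass_AMC_pos[OF m, of False]
    by (simp add: sum_u_levels p_unme_eq p_med_eq sum_divide_distrib sum_distrib_right)
  have "ereal (\<Sum>u\<in>u_levels G c. risk True m u * p_unme G True m c u) / BF G c
     \<le> ereal (\<Sum>u\<in>u_levels G c. risk True m u * p_unme G False m c u)"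
    unfolding BF_def using m
    by (intro bounded_ratio_of_means RR_AU_not_MInf RR_AU_tilt risk_range p_unme_sum)
       (auto simp: p_unme_nonneg risk_nonneg)
  moreover have "0 \<le> p_med G False c m" using m by (simp add: m_levels_def)
  ultimately have "ereal (p_med G False c m) *
      (ereal (\<Sum>u\<in>u_levels G c. risk True m u * p_unme G True m c u) / BF G c)
     \<le> ereal (p_med G False c m) * ereal (\<Sum>u\<in>u_levels G c. risk True m u * p_unme G False m c u)"
    by (intro ereal_mult_left_mono) auto
  then show ?thesis unfolding mean1 mean0
    by (simp add: ereal_times_divide_eq mult.commute)
qed

lemma NIE_upper_bound: "ereal (NIE_true G c) \<le> NIE_bound G c"
proof -
  let ?E = "\<lambda>m. (\<Sum>u\<in>UNIV. risk True m u * mass_AMCU False m u) / mass_AC False"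
  \<comment> \<open>Levels that never occur without exposure are absent from the bound, and they
    contribute nothing to the mediation formula either.\<close>
  have outside: "?E m = 0" if "m \<notin> m_levels G c" for m
  proof -
    have "mass_AMC False m = 0"
      using that mass_AC_pos[of False] measure_nonneg[of "law G"]
      by (auto simp: m_levels_def p_med_eq zero_less_divide_iff mass_AMC_def zero_less_measure_iff)
    then have "mass_AMCU False m u = 0" if "u \<in> u_levels G c" for u
      using that unfolding mass_AMC_sum
      by (subst (asm) sum_nonneg_eq_0_iff) (auto simp: mass_AMCU_def)
    then show ?thesis unfolding sum_u_levels by simp
  qed
  have "(\<Sum>m\<in>m_levels G c.
        ereal (\<P>(\<omega> in law G. outc G \<omega> \<bar> expo G \<omega> = True \<and> medi G \<omega> = m \<and> cova G \<omega> = c)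
               * p_med G False c m) / BF G c) \<le> (\<Sum>m\<in>m_levels G c. ereal (?E m))"
    by (intro sum_mono stratum_bound)
  also have "\<dots> = ereal (\<Sum>m\<in>m_levels G c. ?E m)" by simp
  also have "(\<Sum>m\<in>m_levels G c. ?E m) = (\<Sum>m\<in>UNIV. ?E m)"
    by (rule sum.mono_neutral_left) (use outside in auto)
  also have "\<dots> = \<P>(\<omega> in law G. Y_nested G True False \<omega> \<bar> cova G \<omega> = c)"
    by (simp add: mediation_formula sum_divide_distrib)
  finally show ?thesis
    unfolding NIE_true_def NIE_bound_def observed_risk
    by (simp only: ereal_minus(1)[symmetric] ereal_minus_mono order_refl)
qed

end

section \<open>A model attaining the bound\<close>

text \<open>
  A sample point of type \<open>nat\<close> encodes three independent coins: \<open>coin_A\<close> is the exposure,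
  \<open>coin_U\<close> the unmeasured covariate, and \<open>coin_V\<close> the residual randomness of the outcome.
\<close>

definition coin_A :: "nat \<Rightarrow> bool" where "coin_A \<omega> = fst (from_nat \<omega> :: bool \<times> bool \<times> bool)"
definition coin_U :: "nat \<Rightarrow> bool" where "coin_U \<omega> = fst (snd (from_nat \<omega> :: bool \<times> bool \<times> bool))"
definition coin_V :: "nat \<Rightarrow> bool" where "coin_V \<omega> = snd (snd (from_nat \<omega> :: bool \<times> bool \<times> bool))"

definition coin_law :: "real \<Rightarrow> real \<Rightarrow> nat pmf" where
  "coin_law p q = map_pmf to_nat
     (pair_pmf (bernoulli_pmf (1/2)) (pair_pmf (bernoulli_pmf p) (bernoulli_pmf q)))"

text \<open>
  The flag \<open>b\<close> is set for \<open>\<gamma> = 1\<close>.  In that case \<open>P(U = 1) = 1/\<gamma>\<close> would leave \<open>U\<close> a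
  single level and force \<open>RR\<^sub>U\<^sub>Y = 1\<close>; instead \<open>U\<close> is nondegenerate and the mediator
  is constant, so that conditioning on it selects nothing in either arm.
\<close>

definition extremal_model :: "real \<Rightarrow> real \<Rightarrow> bool \<Rightarrow> 'c \<Rightarrow> (nat, bool, 'c, bool) mediation" where
  "extremal_model p q b c = \<lparr>
     law = measure_pmf (coin_law p q),
     expo = coin_A,
     outc = (\<lambda>\<omega>. coin_U \<omega> \<or> coin_V \<omega>),
     medi = (\<lambda>\<omega>. coin_A \<omega> \<longrightarrow> coin_U \<omega> \<or> b),
     cova = (\<lambda>_. c),
     unme = coin_U,
     Y_pot = (\<lambda>a \<omega>. coin_U \<omega> \<or> coin_V \<omega>),
     M_pot = (\<lambda>a \<omega>. a \<longrightarrow> coin_U \<omega> \<or> b),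
     Y_joint = (\<lambda>a m \<omega>. coin_U \<omega> \<or> coin_V \<omega>)\<rparr>"

lemma extremal_model_simps [simp]:
  "law (extremal_model p q b c) = measure_pmf (coin_law p q)"
  "expo (extremal_model p q b c) = coin_A"
  "outc (extremal_model p q b c) = (\<lambda>\<omega>. coin_U \<omega> \<or> coin_V \<omega>)"
  "medi (extremal_model p q b c) = (\<lambda>\<omega>. coin_A \<omega> \<longrightarrow> coin_U \<omega> \<or> b)"
  "cova (extremal_model p q b c) = (\<lambda>_. c)"
  "unme (extremal_model p q b c) = coin_U"
  "Y_pot (extremal_model p q b c) a = (\<lambda>\<omega>. coin_U \<omega> \<or> coin_V \<omega>)"
  "M_pot (extremal_model p q b c) a = (\<lambda>\<omega>. a \<longrightarrow> coin_U \<omega> \<or> b)"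
  "Y_joint (extremal_model p q b c) a m = (\<lambda>\<omega>. coin_U \<omega> \<or> coin_V \<omega>)"
  by (simp_all add: extremal_model_def)

locale coins =
  fixes p q :: real
  assumes p: "0 < p" "p < 1" and q: "0 < q" "q \<le> 1"
begin

lemma coins_to_nat [simp]:
  "coin_A (to_nat (a, u, v)) = a" "coin_U (to_nat (a, u, v)) = u" "coin_V (to_nat (a, u, v)) = v"
  for a u v :: bool
  by (simp_all add: coin_A_def coin_U_def coin_V_def)

text \<open>
  Probabilities are evaluated by summing over the eight outcomes.  The sum is nested in the order
  of \<open>A\<close>, \<open>U\<close>, \<open>V\<close> because the simplifier can then collapse a coin on which the event
  does not depend, by \<open>q + (1 - q) = 1\<close>.
\<close>

lemma prob_coins:
  "measure (measure_pmf (coin_law p q)) {\<omega>. \<psi> \<omega>} =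
   (p * (q * of_bool (\<psi> (to_nat (True, True, True))) + (1 - q) * of_bool (\<psi> (to_nat (True, True, False)))) +
    (1 - p) * (q * of_bool (\<psi> (to_nat (True, False, True))) + (1 - q) * of_bool (\<psi> (to_nat (True, False, False))))) / 2 +
   (p * (q * of_bool (\<psi> (to_nat (False, True, True))) + (1 - q) * of_bool (\<psi> (to_nat (False, True, False)))) +
    (1 - p) * (q * of_bool (\<psi> (to_nat (False, False, True))) + (1 - q) * of_bool (\<psi> (to_nat (False, False, False))))) / 2"
proof -
  let ?Q = "pair_pmf (bernoulli_pmf (1/2)) (pair_pmf (bernoulli_pmf p) (bernoulli_pmf q))"
  have "measure (measure_pmf (coin_law p q)) {\<omega>. \<psi> \<omega>} = measure ?Q {t. \<psi> (to_nat t)}"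
    by (simp add: coin_law_def vimage_def)
  also have "\<dots> = (\<Sum>t\<in>UNIV. of_bool (\<psi> (to_nat t)) * pmf ?Q t)"
    by (subst measure_measure_pmf_finite)
       (auto simp: of_bool_def if_distrib[of "\<lambda>x. x * _"] sum.If_cases
             intro!: sum.cong cong: if_cong)
  also have "\<dots> = (\<Sum>a\<in>UNIV. \<Sum>u\<in>UNIV. \<Sum>v\<in>UNIV. of_bool (\<psi> (to_nat (a, u, v))) * pmf ?Q (a, u, v))"
    unfolding UNIV_Times_UNIV[symmetric] sum.cartesian_product[symmetric] sum.cartesian_product'
    by (rule refl)
  finally have *: "measure (measure_pmf (coin_law p q)) {\<omega>. \<psi> \<omega>} = \<dots>" .
  show ?thesis
    unfolding * using p q
    by (simp add: UNIV_bool pmf_pair algebra_simps add_divide_distrib diff_divide_distrib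
        split del: split_of_bool)
qed

lemma indep_A:
  "cond_indep (coin_law p q) (\<lambda>\<omega>. coin_U \<omega> \<or> coin_V \<omega>) coin_A (\<lambda>\<omega>. (c, coin_U \<omega>))"
  unfolding cond_indep_def cond_prob_def split_paired_All
proof (intro allI impI, goal_cases)
  case (1 x y c' u)
  show ?case
    using p by (cases "c' = c"; cases x; cases y; cases u) (simp_all add: prob_coins)
qed

lemma indep_AU: "cond_indep (coin_law p q) coin_A coin_U (\<lambda>\<omega>. c)"
  unfolding cond_indep_def cond_prob_def
proof (intro allI impI, goal_cases)
  case (1 x y c')
  show ?case
    using p by (cases "c' = c"; cases x; cases y) (simp_all add: prob_coins)
qed

text \<open>
  Each mediator, potential or observed, is determined by the variables on which its independence
  condition is conditioned.  Only the independence of outcome and exposure, and of exposure and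
  \<open>U\<close>, rests on the independence of the coins.
\<close>

lemma model: "mediation_model (extremal_model p q b c) c"
proof -
  let ?G = "extremal_model p q b c"
  have "no_confounding ?G"
    unfolding no_confounding_def
  proof (intro allI conjI)
    fix a a' m
    show "cond_indep (law ?G) (Y_joint ?G a m) (expo ?G) (\<lambda>\<omega>. (cova ?G \<omega>, unme ?G \<omega>))"
      using indep_A[of c] by simp
    show "cond_indep (law ?G) (Y_joint ?G a m) (medi ?G) (\<lambda>\<omega>. (expo ?G \<omega>, cova ?G \<omega>, unme ?G \<omega>))"
      by (simp, rule cond_indep_of_determined[where h = "\<lambda>(a, c, u). a \<longrightarrow> u \<or> b"]) simp
    show "cond_indep (law ?G) (Y_joint ?G a m) (M_pot ?G a') (\<lambda>\<omega>. (cova ?G \<omega>, unme ?G \<omega>))"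
      by (simp, rule cond_indep_of_determined[where h = "\<lambda>(c, u). a' \<longrightarrow> u \<or> b"]) simp
    show "cond_indep (law ?G) (M_pot ?G a) (expo ?G) (\<lambda>\<omega>. (cova ?G \<omega>, unme ?G \<omega>))"
      by (simp, rule cond_indep_commute, rule cond_indep_of_determined[where h = "\<lambda>(c, u). a \<longrightarrow> u \<or> b"]) simp
  qed
  moreover have "positivity ?G c"
    using p by (auto simp: positivity_def cond_prob_def p_med_def all_bool_eq prob_coins)
  ultimately show ?thesis
    using indep_AU[of c]
    by (simp add: mediation_model_def random_variables_def consistency_def composition_def
        Y_nested_def measure_pmf.prob_space_axioms)
qed

lemma m_levels_eq: "m_levels (extremal_model p q b c) c = {True}"
proof -
  have "p_med (extremal_model p q b c) False c m = of_bool m" for m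
    by (cases m) (simp_all add: p_med_def cond_prob_def prob_coins)
  then show ?thesis by (auto simp: m_levels_def)
qed

lemma u_levels_eq: "u_levels (extremal_model p q b c) c = UNIV"
proof -
  have "\<P>(\<omega> in coin_law p q. coin_U \<omega> = u) > 0" for u
    using p by (cases u) (simp_all add: prob_coins)
  then show ?thesis by (simp add: u_levels_def cond_prob_def)
qed

lemma p_unme_False: "p_unme (extremal_model p q b c) False True c u = (if u then p else 1 - p)"
  using p by (cases u) (simp_all add: p_unme_def cond_prob_def prob_coins field_simps)

lemma p_unme_True: "p_unme (extremal_model p q b c) True True c u =
   (if b then if u then p else 1 - p else of_bool u)"
  using p by (cases u; cases b) (simp_all add: p_unme_def cond_prob_def prob_coins field_simps)

text \<open>
  Unless \<open>b\<close>, the stratum \<open>A = 1, M = 1, U = 0\<close> is null, and its risk \<open>q\<close> is the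
  counterfactual one.  It lowers the minimum in \<open>RR\<^sub>U\<^sub>Y\<close> without entering the observed risk.
\<close>

lemma p_outc_eq: "p_outc (extremal_model p q b c) True True c u = (if u then 1 else q)"
  using p by (cases u; cases b) (simp_all add: p_outc_def cond_prob_def prob_coins field_simps)

lemma RR_AU_eq: "RR_AU (extremal_model p q b c) c = (if b then 1 else ereal (1 / p))"
  using p by (auto simp: RR_AU_def m_levels_eq u_levels_eq p_unme_False p_unme_True UNIV_bool)

lemma RR_UY_eq: "RR_UY (extremal_model p q b c) c = ereal (1 / q)"
  using q by (simp add: RR_UY_def m_levels_eq u_levels_eq p_outc_eq UNIV_bool)

lemma NIE_eq: "NIE_true (extremal_model p q b c) c = 0"
  by (simp add: NIE_true_def Y_nested_def)

text \<open>
  Unless \<open>b\<close>, the sensitivity parameters are \<open>1/p\<close> and \<open>1/q\<close>.  Their inverse bounding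
  factor is the probability that at least one of two independent coins with success probabilities
  \<open>p\<close> and \<open>q\<close> succeeds, that is, the risk \<open>P(Y = 1)\<close> of this model.
\<close>

lemma BF_eq: "BF (extremal_model p q b c) c = (if b then 1 else ereal (1 / (p + (1 - p) * q)))"
proof -
  have "1 / p + 1 / q - 1 = (p + (1 - p) * q) / (p * q)"
    using p q by (simp add: field_simps)
  then show ?thesis
    using p q add_pos_pos[of p "(1 - p) * q"]
    by (auto simp: BF_def bounding_factor_def RR_AU_eq RR_UY_eq one_ereal_def)
qed

lemma bound_eq: "NIE_bound (extremal_model p q b c) c = 0"
proof -
  let ?G = "extremal_model p q b c"
  have pos: "0 < p + (1 - p) * q" using p q by (simp add: add_pos_pos)
  have "\<P>(\<omega> in law ?G. outc ?G \<omega> \<bar> expo ?G \<omega> = True \<and> cova ?G \<omega> = c) = p + (1 - p) * q"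
    by (simp add: cond_prob_def prob_coins)
  moreover have "\<P>(\<omega> in law ?G. outc ?G \<omega> \<bar> expo ?G \<omega> = True \<and> medi ?G \<omega> = True \<and> cova ?G \<omega> = c) =
    (if b then p + (1 - p) * q else 1)"
    using p by (simp add: cond_prob_def prob_coins)
  moreover have "p_med ?G False c True = 1"
    by (simp add: p_med_def cond_prob_def prob_coins)
  ultimately show ?thesis
    using pos by (simp add: NIE_bound_def m_levels_eq BF_eq one_ereal_def zero_ereal_def)
qed

end

text \<open>
  The masses are read off from the two parameters: \<open>P(U = 1) = 1/\<gamma>\<close> and
  \<open>P(Y = 1 | U = 0) = 1/\<delta>\<close>, against \<open>P(Y = 1 | U = 1) = 1\<close>.  For \<open>\<gamma> = 1\<close> any
  nondegenerate law of \<open>U\<close> serves.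
\<close>

lemma bound_attained:
  fixes \<gamma> \<delta> :: real
  assumes "1 \<le> \<gamma>" "1 \<le> \<delta>"
  shows "\<exists>H :: (nat, bool, 'c, bool) mediation.
    mediation_model H c \<and> RR_AU H c = ereal \<gamma> \<and> RR_UY H c = ereal \<delta> \<and>
    ereal (NIE_true H c) = NIE_bound H c"
proof -
  define p where "p = (if \<gamma> = 1 then 1 / 2 else 1 / \<gamma>)"
  interpret coins p "1 / \<delta>"
    using assms by unfold_locales (auto simp: p_def field_simps)
  let ?H = "extremal_model p (1 / \<delta>) (\<gamma> = 1) c"
  have "RR_AU ?H c = ereal \<gamma>"
    unfolding RR_AU_eq by (simp add: p_def one_ereal_def)
  moreover have "RR_UY ?H c = ereal \<delta>"
    by (simp add: RR_UY_eq)
  moreover have "ereal (NIE_true ?H c) = NIE_bound ?H c"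
    by (simp add: NIE_eq bound_eq zero_ereal_def)
  ultimately show ?thesis
    by (intro exI[of _ ?H] conjI model)
qed

theorem theorem4:
  fixes G :: "('w, 'm::finite, 'c::finite, 'u::finite) mediation" and c :: 'c
  shows "(mediation_model G c \<longrightarrow> ereal (NIE_true G c) \<le> NIE_bound G c) \<and>
    (\<forall>\<gamma> \<delta> :: real. \<gamma> \<ge> 1 \<longrightarrow> \<delta> \<ge> 1 \<longrightarrow>
      (\<exists>H :: (nat, bool, 'c, bool) mediation.
         mediation_model H c \<and> RR_AU H c = ereal \<gamma> \<and> RR_UY H c = ereal \<delta> \<and>
         ereal (NIE_true H c) = NIE_bound H c))"
proof (intro conjI impI allI)
  assume "mediation_model G c"
  then interpret mediation_setting G c by unfold_locales
  show "ereal (NIE_true G c) \<le> NIE_bound G c" by (rule NIE_upper_bound)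
next
  fix \<gamma> \<delta> :: real
  assume "\<gamma> \<ge> 1" "\<delta> \<ge> 1"
  then show "\<exists>H :: (nat, bool, 'c, bool) mediation.
      mediation_model H c \<and> RR_AU H c = ereal \<gamma> \<and> RR_UY H c = ereal \<delta> \<and>
      ereal (NIE_true H c) = NIE_bound H c"
    by (rule bound_attained)
qed

end
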